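(* Suppose $\psi(M_1)\neq 0$. Suppose that $V$ is a (nonzero) Whittaker module of type $\psi$ for $\mathfrak{sv}$ such that $M_0$ acts on $V$ by a scalar $\xi\in\mathbb{C}$. Then $V$ is irreducible.
   Context: The Schrödinger-Virasoro algebra $\mathfrak{sv}$ is the complex Lie algebra with basis $\{L_n,M_n,Y_{n+\frac12}\mid n\in\mathbb{Z}\}$ and brackets, for $m,n\in\mathbb{Z}$: $[L_m,L_n]=(n-m)L_{m+n}$, $[L_m,M_n]=nM_{m+n}$, $[L_m,Y_{n+\frac12}]=(n+\frac{1-m}{2})Y_{m+n+\frac12}$, $[Y_{m+\frac12},Y_{n+\frac12}]=(n-m)M_{m+n+1}$, $[M_m,M_n]=[M_m,Y_{n+\frac12}]=0$. The element $M_0$ is central. Put $\mathfrak{sv}^+=\mathrm{span}_{\mathbb{C}}\{L_n,M_n,Y_{m+\frac12}\mid n\geq 1,\ m\geq 0\}$. Let $\psi:\mathfrak{sv}^+\to\mathbb{C}$ be a Lie algebra homomorphism; throughout, $\psi(L_n)=0$ for $n\geq 3$, $\psi(M_m)=0$ for $m\geq 2$, and $\psi(Y_{\frac12+k})=0$ for $k\geq 1$. A vector $v$ in an $\mathfrak{sv}$-module is a Whittaker vector (of type $\psi$) if $xv=\psi(x)v$ for all $x\in\mathfrak{sv}^+$; an $\mathfrak{sv}$-module is a Whittaker module of type $\psi$ if it is generated by a Whittaker vector of type $\psi$. *)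

theory Defs
  imports Complex_Main "HOL-Library.Poly_Mapping"
begin

section \<open>Lie algebras, homomorphisms and modules\<close>

locale lie_algebra = vector_space scale
  for scale :: "'k::field \<Rightarrow> 'g::ab_group_add \<Rightarrow> 'g" +
  fixes bracket :: "'g \<Rightarrow> 'g \<Rightarrow> 'g"
  assumes bracket_linear_left: "\<And>y. Vector_Spaces.linear scale scale (\<lambda>x. bracket x y)"
    and bracket_linear_right: "\<And>x. Vector_Spaces.linear scale scale (\<lambda>y. bracket x y)"
    and bracket_self: "\<And>x. bracket x x = 0"
    and jacobi: "\<And>x y z.
      bracket x (bracket y z) + bracket y (bracket z x) + bracket z (bracket x y) = 0"

definition lie_subalgebra ::
  "('k::field \<Rightarrow> 'g::ab_group_add \<Rightarrow> 'g) \<Rightarrow> ('g \<Rightarrow> 'g \<Rightarrow> 'g) \<Rightarrow> 'g set \<Rightarrow> bool"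
  where "lie_subalgebra scale bracket S \<longleftrightarrow>
    module.subspace scale S \<and> (\<forall>x\<in>S. \<forall>y\<in>S. bracket x y \<in> S)"

text \<open>A homomorphism defined on a subalgebra \<open>S\<close> is represented by a total function whose
  values outside \<open>S\<close> are irrelevant.\<close>

definition lie_hom_on ::
  "('k::field \<Rightarrow> 'g::ab_group_add \<Rightarrow> 'g) \<Rightarrow> ('g \<Rightarrow> 'g \<Rightarrow> 'g) \<Rightarrow> 'g set \<Rightarrow>
   ('k \<Rightarrow> 'h::ab_group_add \<Rightarrow> 'h) \<Rightarrow> ('h \<Rightarrow> 'h \<Rightarrow> 'h) \<Rightarrow> ('g \<Rightarrow> 'h) \<Rightarrow> bool"
  where "lie_hom_on scale1 bracket1 S scale2 bracket2 f \<longleftrightarrow>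
    (\<forall>x\<in>S. \<forall>y\<in>S. f (x + y) = f x + f y) \<and>
    (\<forall>c. \<forall>x\<in>S. f (scale1 c x) = scale2 c (f x)) \<and>
    (\<forall>x\<in>S. \<forall>y\<in>S. f (bracket1 x y) = bracket2 (f x) (f y))"

locale lie_module = alg: lie_algebra gscale bracket + mod: vector_space scale
  for gscale :: "'k::field \<Rightarrow> 'g::ab_group_add \<Rightarrow> 'g"
    and bracket :: "'g \<Rightarrow> 'g \<Rightarrow> 'g"
    and scale :: "'k \<Rightarrow> 'v::ab_group_add \<Rightarrow> 'v" +
  fixes act :: "'g \<Rightarrow> 'v \<Rightarrow> 'v"
  assumes act_linear_left: "\<And>v. Vector_Spaces.linear gscale scale (\<lambda>x. act x v)"
    and act_linear_right: "\<And>x. Vector_Spaces.linear scale scale (act x)"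
    and act_bracket: "\<And>x y v. act (bracket x y) v = act x (act y v) - act y (act x v)"

definition lie_submodule ::
  "('k::field \<Rightarrow> 'v::ab_group_add \<Rightarrow> 'v) \<Rightarrow> ('g \<Rightarrow> 'v \<Rightarrow> 'v) \<Rightarrow> 'v set \<Rightarrow> bool"
  where "lie_submodule scale act U \<longleftrightarrow>
    module.subspace scale U \<and> (\<forall>x. \<forall>u\<in>U. act x u \<in> U)"

definition irreducible_lie_module ::
  "('k::field \<Rightarrow> 'v::ab_group_add \<Rightarrow> 'v) \<Rightarrow> ('g \<Rightarrow> 'v \<Rightarrow> 'v) \<Rightarrow> bool"
  where "irreducible_lie_module scale act \<longleftrightarrow>
    (UNIV :: 'v set) \<noteq> {0} \<and>
    (\<forall>U. lie_submodule scale act U \<longrightarrow> U = {0} \<or> U = UNIV)"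


section \<open>The Schroedinger-Virasoro algebra\<close>

text \<open>The index \<open>IY n\<close> stands for the basis vector $Y_{n + 1/2}$.\<close>

datatype sv_index = IL int | IM int | IY int

type_synonym sv = "sv_index \<Rightarrow>\<^sub>0 complex"

definition sv_scale :: "complex \<Rightarrow> sv \<Rightarrow> sv"
  where "sv_scale c x = Poly_Mapping.map (\<lambda>a. c * a) x"

definition sv_L :: "int \<Rightarrow> sv" where "sv_L n = Poly_Mapping.single (IL n) 1"
definition sv_M :: "int \<Rightarrow> sv" where "sv_M n = Poly_Mapping.single (IM n) 1"
definition sv_Y :: "int \<Rightarrow> sv" where "sv_Y n = Poly_Mapping.single (IY n) 1"

fun sv_basis_bracket :: "sv_index \<Rightarrow> sv_index \<Rightarrow> sv" where
  "sv_basis_bracket (IL m) (IL n) = sv_scale (of_int (n - m)) (sv_L (m + n))"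
| "sv_basis_bracket (IL m) (IM n) = sv_scale (of_int n) (sv_M (m + n))"
| "sv_basis_bracket (IL m) (IY n) = sv_scale (of_int n + (1 - of_int m) / 2) (sv_Y (m + n))"
| "sv_basis_bracket (IM m) (IL n) = - sv_scale (of_int m) (sv_M (n + m))"
| "sv_basis_bracket (IM m) (IM n) = 0"
| "sv_basis_bracket (IM m) (IY n) = 0"
| "sv_basis_bracket (IY m) (IL n) = - sv_scale (of_int m + (1 - of_int n) / 2) (sv_Y (n + m))"
| "sv_basis_bracket (IY m) (IM n) = 0"
| "sv_basis_bracket (IY m) (IY n) = sv_scale (of_int (n - m)) (sv_M (m + n + 1))"

definition sv_bracket :: "sv \<Rightarrow> sv \<Rightarrow> sv"
  where "sv_bracket x y = (\<Sum>i\<in>Poly_Mapping.keys x. \<Sum>j\<in>Poly_Mapping.keys y.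
    sv_scale (Poly_Mapping.lookup x i * Poly_Mapping.lookup y j) (sv_basis_bracket i j))"

lemma lookup_sv_scale [simp]:
  "Poly_Mapping.lookup (sv_scale c x) i = c * Poly_Mapping.lookup x i"
  by (simp add: sv_scale_def Poly_Mapping.map.rep_eq when_def)

interpretation sv: vector_space sv_scale
  by unfold_locales (auto intro!: poly_mapping_eqI simp: lookup_add algebra_simps)

definition sv_plus :: "sv set"
  where "sv_plus = sv.span ({sv_L n |n. n \<ge> 1} \<union> {sv_M n |n. n \<ge> 1} \<union> {sv_Y m |m. m \<ge> 0})"

lemma sv_bracket_eq_sum:
  assumes "finite A" "finite B" "Poly_Mapping.keys x \<subseteq> A" "Poly_Mapping.keys y \<subseteq> B"
  shows "sv_bracket x y = (\<Sum>i\<in>A. \<Sum>j\<in>B.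
    sv_scale (Poly_Mapping.lookup x i * Poly_Mapping.lookup y j) (sv_basis_bracket i j))"
proof -
  have "sv_bracket x y = (\<Sum>i\<in>Poly_Mapping.keys x. \<Sum>j\<in>B.
    sv_scale (Poly_Mapping.lookup x i * Poly_Mapping.lookup y j) (sv_basis_bracket i j))"
    unfolding sv_bracket_def
    by (intro sum.cong refl sum.mono_neutral_left) (use assms in \<open>auto simp: in_keys_iff\<close>)
  also have "\<dots> = (\<Sum>i\<in>A. \<Sum>j\<in>B.
    sv_scale (Poly_Mapping.lookup x i * Poly_Mapping.lookup y j) (sv_basis_bracket i j))"
    by (intro sum.mono_neutral_left) (use assms in \<open>auto simp: in_keys_iff\<close>)
  finally show ?thesis .
qed

lemma sv_bracket_add_left: "sv_bracket (x + x') y = sv_bracket x y + sv_bracket x' y"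
proof -
  let ?A = "Poly_Mapping.keys x \<union> Poly_Mapping.keys x'" and ?B = "Poly_Mapping.keys y"
  have "Poly_Mapping.keys (x + x') \<subseteq> ?A" by (rule keys_add)
  then show ?thesis
    by (subst (1 2 3) sv_bracket_eq_sum[of ?A ?B])
       (auto simp: lookup_add distrib_right sv.scale_left_distrib sum.distrib)
qed

lemma sv_bracket_add_right: "sv_bracket y (x + x') = sv_bracket y x + sv_bracket y x'"
proof -
  let ?A = "Poly_Mapping.keys x \<union> Poly_Mapping.keys x'" and ?B = "Poly_Mapping.keys y"
  have "Poly_Mapping.keys (x + x') \<subseteq> ?A" by (rule keys_add)
  then show ?thesis
    by (subst (1 2 3) sv_bracket_eq_sum[of ?B ?A])
       (auto simp: lookup_add distrib_left sv.scale_left_distrib sum.distrib)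
qed

lemma keys_sv_scale: "Poly_Mapping.keys (sv_scale c x) \<subseteq> Poly_Mapping.keys x"
  by (auto simp: in_keys_iff)

lemma sv_bracket_scale_left: "sv_bracket (sv_scale c x) y = sv_scale c (sv_bracket x y)"
  by (subst (1 2) sv_bracket_eq_sum[of "Poly_Mapping.keys x" "Poly_Mapping.keys y"])
     (use keys_sv_scale[of c x] in \<open>auto simp: sv.scale_sum_right mult_ac\<close>)

lemma sv_bracket_scale_right: "sv_bracket y (sv_scale c x) = sv_scale c (sv_bracket y x)"
  by (subst (1 2) sv_bracket_eq_sum[of "Poly_Mapping.keys y" "Poly_Mapping.keys x"])
     (use keys_sv_scale[of c x] in \<open>auto simp: sv.scale_sum_right mult_ac\<close>)

lemma sv_linearI:
  assumes "\<And>x y. f (x + y) = f x + f y" "\<And>c x. f (sv_scale c x) = sv_scale c (f x)"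
  shows "Vector_Spaces.linear sv_scale sv_scale f"
  by unfold_locales (use assms in auto)

lemma sv_bracket_linear_left: "Vector_Spaces.linear sv_scale sv_scale (\<lambda>x. sv_bracket x y)"
  by (intro sv_linearI sv_bracket_add_left sv_bracket_scale_left)

lemma sv_bracket_linear_right: "Vector_Spaces.linear sv_scale sv_scale (\<lambda>y. sv_bracket x y)"
  by (intro sv_linearI sv_bracket_add_right sv_bracket_scale_right)

lemma sv_bracket_single [simp]:
  "sv_bracket (Poly_Mapping.single i 1) (Poly_Mapping.single j 1) = sv_basis_bracket i j"
  by (simp add: sv_bracket_def)

lemma sv_bracket_zero [simp]: "sv_bracket 0 x = 0" "sv_bracket x 0 = 0"
  by (simp_all add: sv_bracket_def)

lemma sv_bracket_minus [simp]:
  "sv_bracket (- x) y = - sv_bracket x y" "sv_bracket y (- x) = - sv_bracket y x"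
  using sv_bracket_scale_left[of "-1" x y] sv_bracket_scale_right[of y "-1" x] by simp_all

lemma sv_induct [case_names zero add scale basis]:
  assumes "P 0" "\<And>x y. P x \<Longrightarrow> P y \<Longrightarrow> P (x + y)" "\<And>c x. P x \<Longrightarrow> P (sv_scale c x)"
    "\<And>i. P (Poly_Mapping.single i 1)"
  shows "P x"
proof -
  have x: "x = (\<Sum>i\<in>Poly_Mapping.keys x.
      sv_scale (Poly_Mapping.lookup x i) (Poly_Mapping.single i 1))"
  proof (rule poly_mapping_eqI)
    fix k
    have "(\<Sum>i\<in>Poly_Mapping.keys x. Poly_Mapping.lookup x i * (1 when i = k)) =
        (\<Sum>i\<in>Poly_Mapping.keys x. if i = k then Poly_Mapping.lookup x k else 0)"
      by (intro sum.cong) (auto simp: when_def)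
    then show "Poly_Mapping.lookup x k = Poly_Mapping.lookup (\<Sum>i\<in>Poly_Mapping.keys x.
      sv_scale (Poly_Mapping.lookup x i) (Poly_Mapping.single i 1)) k"
      by (simp add: lookup_sum lookup_single in_keys_iff)
  qed
  have "P (\<Sum>i\<in>A. sv_scale (Poly_Mapping.lookup x i) (Poly_Mapping.single i 1))" if "finite A" for A
    using that by (induction A rule: finite_induct) (auto intro: assms)
  from this[OF finite_keys, of x] show ?thesis
    using x by simp
qed

lemma sv_bracket_L_L: "sv_bracket (sv_L m) (sv_L n) = sv_scale (of_int (n - m)) (sv_L (m + n))"
  and sv_bracket_L_M: "sv_bracket (sv_L m) (sv_M n) = sv_scale (of_int n) (sv_M (m + n))"
  and sv_bracket_L_Y: "sv_bracket (sv_L m) (sv_Y n) =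
        sv_scale (of_int n + (1 - of_int m) / 2) (sv_Y (m + n))"
  and sv_bracket_Y_Y: "sv_bracket (sv_Y m) (sv_Y n) =
        sv_scale (of_int (n - m)) (sv_M (m + n + 1))"
  and sv_bracket_M_M: "sv_bracket (sv_M m) (sv_M n) = 0"
  and sv_bracket_M_Y: "sv_bracket (sv_M m) (sv_Y n) = 0"
  by (simp_all add: sv_L_def sv_M_def sv_Y_def)

lemma sv_basis_bracket_antisym: "sv_basis_bracket i j = - sv_basis_bracket j i"
  by (cases i; cases j; rule poly_mapping_eqI)
     (auto simp: sv_L_def sv_M_def sv_Y_def lookup_single algebra_simps)

lemma sv_bracket_antisym: "sv_bracket x y = - sv_bracket y x"
proof (induction x arbitrary: y rule: sv_induct)
  case (basis i)
  show ?case
    by (induction y rule: sv_induct)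
       (simp_all add: sv_bracket_add_right sv_bracket_add_left sv_bracket_scale_right
          sv_bracket_scale_left sv_basis_bracket_antisym[of i])
qed (simp_all add: sv_bracket_add_right sv_bracket_add_left sv_bracket_scale_right
          sv_bracket_scale_left)

lemma sv_jacobi_basis:
  "sv_bracket (Poly_Mapping.single i 1) (sv_basis_bracket j k) +
   sv_bracket (Poly_Mapping.single j 1) (sv_basis_bracket k i) +
   sv_bracket (Poly_Mapping.single k 1) (sv_basis_bracket i j) = 0"
  by (cases i; cases j; cases k; rule poly_mapping_eqI)
     (auto simp: sv_L_def sv_M_def sv_Y_def lookup_single lookup_add lookup_minus
        sv_bracket_scale_right when_def add_ac, (simp add: field_simps)+)

lemma sv_jacobi:
  "sv_bracket x (sv_bracket y z) + sv_bracket y (sv_bracket z x) +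
   sv_bracket z (sv_bracket x y) = 0" (is "?J x y z = 0")
proof -
  note lin = sv_bracket_add_right sv_bracket_add_left sv_bracket_scale_right
          sv_bracket_scale_left
  have J_add: "?J (x + x') y z = ?J x y z + ?J x' y z" for x x' y z
    by (simp add: lin)
  have J_scale: "?J (sv_scale c x) y z = sv_scale c (?J x y z)" for c x y z
    by (simp add: lin sv.scale_right_distrib)
  have cyc: "?J x y z = ?J y z x" for x y z
    by (simp add: add_ac)
  have 1: "?J z (Poly_Mapping.single i 1) (Poly_Mapping.single j 1) = 0" for i j z
  proof (induction z rule: sv_induct)
    case (basis k) show ?case by (simp add: sv_jacobi_basis)
  next
    case (add x x') then show ?case by (simp only: J_add) simp
  next
    case (scale c x) then show ?case by (simp only: J_scale) simp
  qed simp
  have 2: "?J (Poly_Mapping.single i 1) y z = 0" for i y z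
  proof -
    have "?J y z (Poly_Mapping.single i 1) = 0"
    proof (induction y rule: sv_induct)
      case (basis k) show ?case using 1[of z i k] cyc by metis
    next
      case (add x x') then show ?case by (simp only: J_add) simp
    next
      case (scale c x) then show ?case by (simp only: J_scale) simp
    qed simp
    then show ?thesis using cyc by metis
  qed
  show ?thesis
  proof (induction x rule: sv_induct)
    case (basis k) show ?case using 2 .
  next
    case (add x x') then show ?case by (simp only: J_add) simp
  next
    case (scale c x) then show ?case by (simp only: J_scale) simp
  qed simp
qed

lemma lie_algebra_sv: "lie_algebra sv_scale sv_bracket"
proof unfold_locales
  fix x y z :: sv
  show "sv_bracket x x = 0"
  proof (rule poly_mapping_eqI)
    fix k
    have "Poly_Mapping.lookup (sv_bracket x x) k = - Poly_Mapping.lookup (sv_bracket x x) k"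
      by (metis sv_bracket_antisym lookup_uminus uminus_apply)
    then show "Poly_Mapping.lookup (sv_bracket x x) k = Poly_Mapping.lookup 0 k" by simp
  qed
qed (rule sv_jacobi sv_bracket_add_left sv_bracket_add_right sv_bracket_scale_left
       sv_bracket_scale_right)+

lemma sv_M_0_central: "sv_bracket (sv_M 0) x = 0"
proof (induction x rule: sv_induct)
  case (basis i) then show ?case by (cases i) (simp_all add: sv_M_def)
qed (simp_all add: sv_bracket_add_right sv_bracket_scale_right)

lemma lie_subalgebra_sv_plus: "lie_subalgebra sv_scale sv_bracket sv_plus"
proof -
  let ?G = "{sv_L n |n. n \<ge> 1} \<union> {sv_M n |n. n \<ge> 1} \<union> {sv_Y m |m. m \<ge> 0}"
  have gen: "sv_L n \<in> sv_plus" "sv_M n \<in> sv_plus" if "n \<ge> 1" for n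
    using that by (auto simp: sv_plus_def intro!: sv.span_base)
  have genY: "sv_Y n \<in> sv_plus" if "n \<ge> 0" for n
    using that by (auto simp: sv_plus_def intro!: sv.span_base)
  have sub: "sv.subspace sv_plus" by (simp add: sv_plus_def)
  have base: "sv_bracket x y \<in> sv_plus" if "x \<in> ?G" "y \<in> ?G" for x y
    using that sub
    by (auto simp: sv_bracket_L_L sv_bracket_L_M sv_bracket_L_Y sv_bracket_Y_Y sv_bracket_M_M
        sv_bracket_M_Y sv_bracket_antisym[of "sv_M _" "sv_L _"]
        sv_bracket_antisym[of "sv_Y _" "sv_L _"] sv_bracket_antisym[of "sv_Y _" "sv_M _"]
        intro!: sv.subspace_scale sv.subspace_neg gen genY sv.subspace_0)
  have left: "sv_bracket x y \<in> sv_plus" if "x \<in> ?G" "y \<in> sv_plus" for x y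
    using that(2) unfolding sv_plus_def
    by (induction rule: sv.span_induct_alt)
       (use base[OF that(1)] sub in \<open>auto simp: sv_bracket_add_right sv_bracket_scale_right
          sv_plus_def[symmetric] intro!: sv.subspace_add sv.subspace_scale sv.subspace_0\<close>)
  have "sv_bracket x y \<in> sv_plus" if "x \<in> sv_plus" "y \<in> sv_plus" for x y
    using that(1) unfolding sv_plus_def
    by (induction rule: sv.span_induct_alt)
       (use left[OF _ that(2)] sub in \<open>auto simp: sv_bracket_add_left sv_bracket_scale_left
          sv_plus_def[symmetric] intro!: sv.subspace_add sv.subspace_scale sv.subspace_0\<close>)
  with sub show ?thesis by (auto simp: lie_subalgebra_def)
qed


section \<open>Whittaker modules\<close>

text \<open>The target \<open>\<complex>\<close> is the abelian Lie algebra. It does not follow from the homomorphism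
  property that \<open>\<psi>\<close> kills $Y_{3/2}$, since $[L_1, Y_{1/2}] = 0$; this is a separate assumption.\<close>

definition whittaker_character :: "(sv \<Rightarrow> complex) \<Rightarrow> bool"
  where "whittaker_character \<psi> \<longleftrightarrow>
    lie_hom_on sv_scale sv_bracket sv_plus (*) (\<lambda>_ _. 0) \<psi> \<and>
    (\<forall>n\<ge>3. \<psi> (sv_L n) = 0) \<and> (\<forall>m\<ge>2. \<psi> (sv_M m) = 0) \<and> (\<forall>k\<ge>1. \<psi> (sv_Y k) = 0)"

definition whittaker_vector ::
  "(complex \<Rightarrow> 'v::ab_group_add \<Rightarrow> 'v) \<Rightarrow> (sv \<Rightarrow> 'v \<Rightarrow> 'v) \<Rightarrow> (sv \<Rightarrow> complex) \<Rightarrow> 'v \<Rightarrow> bool"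
  where "whittaker_vector scale act \<psi> v \<longleftrightarrow> (\<forall>x\<in>sv_plus. act x v = scale (\<psi> x) v)"

definition whittaker_module ::
  "(complex \<Rightarrow> 'v::ab_group_add \<Rightarrow> 'v) \<Rightarrow> (sv \<Rightarrow> 'v \<Rightarrow> 'v) \<Rightarrow> (sv \<Rightarrow> complex) \<Rightarrow> bool"
  where "whittaker_module scale act \<psi> \<longleftrightarrow>
    lie_module sv_scale sv_bracket scale act \<and>
    (\<exists>w. whittaker_vector scale act \<psi> w \<and> lie_submodule scale act hull {w} = UNIV)"

end

theory Submission
  imports Defs
begin

text \<open>
  The module resembles a Fock space: the basis elements \<open>L_k\<close> (\<open>k \<le> 0\<close>), \<open>M_k\<close> (\<open>k < 0\<close>) and
  \<open>Y_{k + 1/2}\<close> (\<open>k < 0\<close>) create all vectors from the cyclic Whittaker vector \<open>w\<close>, while elements of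
  the positive part, shifted by their \<open>\<psi>\<close>-values, kill \<open>w\<close>. Because \<open>\<psi>(M_1) \<noteq> 0\<close>, the brackets
  \<open>[M_{1 - n}, L_n]\<close>, \<open>[L_{1 - n}, M_n]\<close> and \<open>[Y_{-n + 1/2}, Y_{n + 1/2}]\<close> are nonzero multiples of \<open>M_1\<close>
  and pair every creating element with one of the positive part. The latter hence act like partial
  derivatives with respect to the former, and a nonzero vector can be differentiated down to a
  nonzero multiple of \<open>w\<close>.

  To make this precise in an arbitrary quotient of the universal Whittaker module, where monomials
  applied to \<open>w\<close> may be linearly dependent, leading terms are replaced by a filtration. The
  function \<open>wt\<close> gives positive weight exactly to the creating elements, and brackets lower the total
  weight by one. Let \<open>filt d\<close> be the span of all words of creating elements of total weight at most
  \<open>d\<close>, applied to \<open>w\<close>. Each basis element minus its scalar \<open>\<chi>\<close> shifts this filtration by its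
  weight (\<open>A_filt\<close>). Suitable combinations \<open>D i\<close> of the shifted operators satisfy
  \<open>[D i, X j] = \<delta>_{ij}\<close> up to terms of lower order (\<open>D_X_commute\<close>). Therefore the Euler operator,
  the sum of all \<open>wt i \<cdot> X i \<circ> D i\<close>, acts on \<open>filt d\<close> as multiplication by \<open>d\<close> modulo
  \<open>filt (d - 1)\<close> (\<open>euler_leading\<close>).

  Now let \<open>v\<close> be a nonzero vector of a submodule, lying in \<open>filt d\<close> with \<open>d > 0\<close>. If some \<open>D i v\<close> is
  nonzero, it is a nonzero vector of the submodule of lower degree. Otherwise the Euler operator
  kills \<open>v\<close>, so that \<open>d \<cdot> v\<close>, and with it \<open>v\<close>, lies in \<open>filt (d - 1)\<close>. Either way the
  degree drops, until it reaches \<open>filt 0\<close>, which consists of the multiples of \<open>w\<close>. Hence \<open>w\<close> lies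
  in the submodule, which is then everything.
\<close>

section \<open>The weight of a basis element\<close>

abbreviation basis_vec :: "sv_index \<Rightarrow> sv"
  where "basis_vec i \<equiv> Poly_Mapping.single i 1"

text \<open>Shifted by one, this is a grading of the Lie algebra. The shift is chosen such that the paired
  elements, whose bracket is a multiple of \<open>M_1\<close>, have opposite weights. The basis elements that act
  on the Whittaker vector by a nonzero scalar have weight \<open>-1\<close> or \<open>0\<close>, so that replacing a bracket
  by its scalar raises degrees by at most one.\<close>

fun wt :: "sv_index \<Rightarrow> int" where
  "wt (IL n) = 1 - n"
| "wt (IM n) = - n"
| "wt (IY n) = - n"

lemma basis_bracket_weight:
  "\<exists>c k. sv_basis_bracket i j = sv_scale c (basis_vec k) \<and> wt k = wt i + wt j - 1"
proof -
  have zero: "\<exists>c k. 0 = sv_scale c (basis_vec k) \<and> wt k = n" for n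
    by (rule exI[of _ 0], rule exI[of _ "IM (- n)"]) simp
  have single: "\<exists>c' k'. sv_scale c (basis_vec k) = sv_scale c' (basis_vec k') \<and> wt k' = n"
    if "wt k = n" for c k n
    using that by blast
  have minus: "- sv_scale c x = sv_scale (- c) x" for c x
    by simp
  show ?thesis
    by (cases i; cases j; hypsubst;
        unfold sv_basis_bracket.simps sv_L_def sv_M_def sv_Y_def minus;
        (rule zero | (rule single, simp)))
qed

lemma finite_wt_bounded: "finite {i. 1 \<le> wt i \<and> wt i \<le> N}"
proof (rule finite_subset)
  show "{i. 1 \<le> wt i \<and> wt i \<le> N} \<subseteq> IL ` {1 - N..0} \<union> IM ` {- N..0} \<union> IY ` {- N..0}"
  proof
    fix i assume "i \<in> {i. 1 \<le> wt i \<and> wt i \<le> N}"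
    then show "i \<in> IL ` {1 - N..0} \<union> IM ` {- N..0} \<union> IY ` {- N..0}"
      by (cases i) auto
  qed
qed simp

section \<open>The filtration of a Whittaker module\<close>

locale scalar_whittaker = lie_module sv_scale sv_bracket scale act
  for scale :: "complex \<Rightarrow> 'v::ab_group_add \<Rightarrow> 'v" and act :: "sv \<Rightarrow> 'v \<Rightarrow> 'v" +
  fixes \<psi> :: "sv \<Rightarrow> complex" and \<xi> :: complex and w :: 'v
  assumes character: "whittaker_character \<psi>"
    and \<psi>_M1: "\<psi> (sv_M 1) \<noteq> 0"
    and M0_scalar: "\<And>v. act (sv_M 0) v = scale \<xi> v"
    and whittaker: "whittaker_vector scale act \<psi> w"
begin

lemmas act_hom_right = Vector_Spaces.linear.axioms(3)[OF act_linear_right]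
lemmas act_add_right = module_hom.add[OF act_hom_right]
lemmas act_scale_right = module_hom.scale[OF act_hom_right]

lemma act_zero_right [simp]: "act x 0 = 0"
  using act_scale_right[of x 0 0] by simp

lemma act_minus_right: "act x (- v) = - act x v"
  using act_scale_right[of x "-1" v] by simp

lemma act_diff_right: "act x (u - v) = act x u - act x v"
  using act_add_right[of x u "- v"] by (simp add: act_minus_right)

lemma act_sum_right: "act x (sum f S) = (\<Sum>i\<in>S. act x (f i))"
  by (induction S rule: infinite_finite_induct) (simp_all add: act_add_right)

lemmas act_hom_left = Vector_Spaces.linear.axioms(3)[OF act_linear_left]
lemmas act_add_left = module_hom.add[OF act_hom_left]
lemmas act_scale_left = module_hom.scale[OF act_hom_left]

abbreviation X :: "sv_index \<Rightarrow> 'v \<Rightarrow> 'v"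
  where "X i \<equiv> act (basis_vec i)"

text \<open>\<open>\<chi> i\<close> is the eigenvalue of \<open>X i\<close> on \<open>w\<close> for \<open>wt i \<le> 0\<close>, the central element \<open>M_0\<close> included. The
  value 0 at creating elements lets \<open>A\<close> treat all basis elements alike.\<close>

definition \<chi> :: "sv_index \<Rightarrow> complex"
  where "\<chi> i = (if 1 \<le> wt i then 0 else if i = IM 0 then \<xi> else \<psi> (basis_vec i))"

definition A :: "sv_index \<Rightarrow> 'v \<Rightarrow> 'v"
  where "A i v = X i v - scale (\<chi> i) v"

lemma basis_vec_plus: "basis_vec i \<in> sv_plus" if "wt i \<le> 0" "i \<noteq> IM 0"
proof (cases i)
  case (IL n)
  then show ?thesis
    using that unfolding sv_plus_def sv_L_def by (intro sv.span_base) auto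
next
  case (IM n)
  then have "n \<ge> 1"
    using that by (cases "n = 0") auto
  with IM show ?thesis
    unfolding sv_plus_def sv_M_def by (intro sv.span_base) auto
next
  case (IY n)
  then show ?thesis
    using that unfolding sv_plus_def sv_Y_def by (intro sv.span_base) auto
qed

lemma X_whittaker: "X i w = scale (\<chi> i) w" if "wt i \<le> 0"
proof (cases "i = IM 0")
  case True
  then show ?thesis
    using M0_scalar[of w] by (simp add: \<chi>_def sv_M_def)
next
  case False
  then show ?thesis
    using that basis_vec_plus[OF that False] whittaker
    by (simp add: \<chi>_def whittaker_vector_def)
qed

lemma \<chi>_low_weight: "\<chi> i = 0" if "wt i < -1"
proof -
  have "\<psi> (basis_vec i) = 0"
    using that character
    by (cases i) (auto simp: whittaker_character_def sv_L_def sv_M_def sv_Y_def)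
  moreover have "i \<noteq> IM 0"
    using that by auto
  ultimately show ?thesis
    using that by (simp add: \<chi>_def)
qed

lemma \<psi>_scale: "\<psi> (sv_scale c x) = c * \<psi> x" if "x \<in> sv_plus"
  using character that by (auto simp: whittaker_character_def lie_hom_on_def)

lemma A_add: "A i (u + v) = A i u + A i v"
  by (simp add: A_def act_add_right mod.scale_right_distrib)

lemma A_scale: "A i (scale c v) = scale c (A i v)"
  by (simp add: A_def act_scale_right mod.scale_right_diff_distrib mult.commute)

lemma A_zero [simp]: "A i 0 = 0"
  by (simp add: A_def)

lemma A_eq_X: "A i v = X i v" if "1 \<le> wt i"
  using that by (simp add: A_def \<chi>_def)

text \<open>The slack \<open>d + wt j \<le> e\<close> in the last rule makes the filtration increasing. Indices are
  integers because lowering operators lead below 0, where the filtration is trivial.\<close>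

inductive filt :: "int \<Rightarrow> 'v \<Rightarrow> bool" where
  zero: "filt d 0"
| add: "filt d u \<Longrightarrow> filt d v \<Longrightarrow> filt d (u + v)"
| scale: "filt d v \<Longrightarrow> filt d (scale c v)"
| gen: "0 \<le> d \<Longrightarrow> filt d w"
| step: "filt d v \<Longrightarrow> 1 \<le> wt j \<Longrightarrow> d + wt j \<le> e \<Longrightarrow> filt e (X j v)"

lemma filt_mono: "filt d v \<Longrightarrow> d \<le> e \<Longrightarrow> filt e v"
proof (induction arbitrary: e rule: filt.induct)
  case (step d v j d')
  then show ?case
    by (intro filt.step[of d]) auto
qed (auto intro: filt.intros)

lemma filt_minus: "filt d v \<Longrightarrow> filt d (- v)"
  using filt.scale[of d v "-1"] by simp

lemma filt_diff: "filt d u \<Longrightarrow> filt d v \<Longrightarrow> filt d (u - v)"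
  using filt.add[of d u "- v"] by (simp add: filt_minus)

lemma filt_sum: "(\<And>i. i \<in> S \<Longrightarrow> filt d (f i)) \<Longrightarrow> filt d (sum f S)"
  by (induction S rule: infinite_finite_induct) (auto intro: filt.intros)

lemma filt_negative: "filt d v \<Longrightarrow> d < 0 \<Longrightarrow> v = 0"
  by (induction rule: filt.induct) auto

lemma filt_0: "filt d v \<Longrightarrow> d = 0 \<Longrightarrow> \<exists>c. v = scale c w"
proof (induction rule: filt.induct)
  case (zero d)
  show ?case
    by (rule exI[of _ 0]) simp
next
  case (add d u v)
  then show ?case
    by (metis mod.scale_left_distrib)
next
  case (scale d v c)
  then show ?case
    by (metis mod.scale_scale)
next
  case (gen d)
  show ?case
    by (rule exI[of _ 1]) simp
next
  case (step d v j e)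
  then have "v = 0"
    by (intro filt_negative[of d]) auto
  then show ?case
    by (intro exI[of _ 0]) simp
qed

lemma A_commute:
  obtains c k where "sv_basis_bracket i j = sv_scale c (basis_vec k)"
    "wt k = wt i + wt j - 1"
    "\<And>v. A i (X j v) - X j (A i v) = scale c (A k v) + scale (c * \<chi> k) v"
proof -
  obtain c k where k: "sv_basis_bracket i j = sv_scale c (basis_vec k)"
      "wt k = wt i + wt j - 1"
    using basis_bracket_weight by blast
  have "A i (X j v) - X j (A i v) = scale c (A k v) + scale (c * \<chi> k) v" for v
  proof -
    have "A i (X j v) - X j (A i v) = X i (X j v) - X j (X i v)"
      by (simp add: A_def act_diff_right act_scale_right)
    also have "\<dots> = act (sv_bracket (basis_vec i) (basis_vec j)) v"
      by (simp only: act_bracket)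
    also have "\<dots> = scale c (X k v)"
      by (simp add: k(1) act_scale_left)
    finally show ?thesis
      by (simp add: A_def mod.scale_right_diff_distrib)
  qed
  with k that show ?thesis by blast
qed

text \<open>A shifted operator is moved to the right through a word until it reaches \<open>w\<close>. The commutator
  with a letter \<open>X j\<close> contributes a multiple of \<open>A k\<close>, which is one degree better than needed, and
  the scalar \<open>\<chi> k\<close>. The latter is nonzero only if \<open>wt k \<ge> -1\<close>, that is \<open>wt i + wt j \<ge> 0\<close>, and then
  the shorter word without \<open>X j\<close> has small enough degree as well.\<close>

lemma A_filt: "filt d v \<Longrightarrow> filt (d + wt i) (A i v)"
proof (induction arbitrary: i rule: filt.induct)
  case (zero d)
  then show ?case by (simp add: filt.zero)
next
  case (add d u v)
  then show ?case by (simp add: A_add filt.add)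
next
  case (scale d v c)
  then show ?case by (simp add: A_scale filt.scale)
next
  case (gen d)
  show ?case
  proof (cases "1 \<le> wt i")
    case True
    with gen show ?thesis
      by (simp add: A_eq_X filt.step[OF filt.gen])
  next
    case False
    then show ?thesis
      by (simp add: A_def X_whittaker filt.zero)
  qed
next
  case (step d v j e)
  obtain c k where k: "wt k = wt i + wt j - 1"
      "\<And>v. A i (X j v) - X j (A i v) = scale c (A k v) + scale (c * \<chi> k) v"
    using A_commute by metis
  have eq: "A i (X j v) = X j (A i v) + (scale c (A k v) + scale (c * \<chi> k) v)"
    using k(2)[of v] by (simp add: algebra_simps)
  have 1: "filt (e + wt i) (X j (A i v))"
    using step by (intro filt.step[of "d + wt i"]) auto
  have 2: "filt (e + wt i) (A k v)"
    using step k(1) by (intro filt_mono[OF step.IH[of k]]) auto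
  have 3: "filt (e + wt i) (scale (c * \<chi> k) v)"
  proof (cases "wt k < -1")
    case True
    then show ?thesis
      by (simp add: \<chi>_low_weight filt.zero)
  next
    case False
    then show ?thesis
      using step k(1) by (intro filt.scale filt_mono[OF step.hyps(1)]) auto
  qed
  show ?case
    unfolding eq by (intro filt.add filt.scale 1 2 3)
qed

abbreviation \<kappa> :: "sv_index \<Rightarrow> sv_index \<Rightarrow> complex"
  where "\<kappa> i j \<equiv> if wt i + wt j = 0 then \<psi> (sv_basis_bracket i j) else 0"

text \<open>To leading order the shifted operators obey commutation relations of Weyl algebra type, with
  structure constants \<open>\<kappa>\<close>. By \<open>basis_bracket_weight\<close> the commutator is a multiple of a
  single \<open>X k\<close>, and \<open>A k\<close> already has the required weight, so only the scalar \<open>\<chi> k\<close> matters. It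
  vanishes if the weights of \<open>i\<close> and \<open>j\<close> add up to a negative number, is of lower order if the
  sum is positive, and is the constant \<open>\<kappa> i j\<close> if the sum is zero.\<close>

lemma A_X_commute_leading:
  assumes "filt d v"
  shows "filt (d + wt i + wt j - 1) (A i (X j v) - X j (A i v)
    - scale (\<kappa> i j) v)"
proof -
  obtain c k where k: "sv_basis_bracket i j = sv_scale c (basis_vec k)"
      "wt k = wt i + wt j - 1"
      "\<And>v. A i (X j v) - X j (A i v) = scale c (A k v) + scale (c * \<chi> k) v"
    using A_commute by metis
  have main: "filt (d + wt i + wt j - 1) (scale c (A k v))"
    using A_filt[OF assms, of k] k(2) by (intro filt.scale) (simp add: algebra_simps)
  have const: "filt (d + wt i + wt j - 1) (scale (c * \<chi> k - \<kappa> i j) v)"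
  proof (cases "wt i + wt j" "0 :: int" rule: linorder_cases)
    case less
    then have "\<chi> k = 0"
      using k(2) by (intro \<chi>_low_weight) auto
    with less show ?thesis
      by (simp add: filt.zero)
  next
    case equal
    then have wk: "wt k = -1"
      using k(2) by simp
    then have "k \<noteq> IM 0" by auto
    with wk have "\<chi> k = \<psi> (basis_vec k)" "basis_vec k \<in> sv_plus"
      by (simp_all add: \<chi>_def basis_vec_plus)
    then have "c * \<chi> k - \<kappa> i j = 0"
      using equal by (simp add: k(1) \<psi>_scale)
    then show ?thesis
      by (simp add: filt.zero)
  next
    case greater
    then show ?thesis
      by (intro filt.scale filt_mono[OF assms]) auto
  qed
  have "A i (X j v) - X j (A i v) - scale (\<kappa> i j) v
      = scale c (A k v) + scale (c * \<chi> k - \<kappa> i j) v"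
    using k(3)[of v] by (simp only: mod.scale_left_diff_distrib) (simp add: algebra_simps)
  then show ?thesis
    using filt.add[OF main const] by simp
qed

section \<open>Dual operators and the Euler operator\<close>

text \<open>The operators \<open>D i\<close> invert the matrix \<open>\<kappa>\<close>. That matrix pairs \<open>L_{1 - n}\<close> not only with \<open>M_n\<close>:
  since \<open>[L_{1 - n}, L_{n + 1}] = 2 n L_2\<close>, it also pairs it with \<open>L_{n + 1}\<close>, by a multiple of
  \<open>\<psi>(L_2)\<close>. As \<open>[M_{-n}, L_{n + 1}] = n M_1\<close>, adding \<open>\<tau>\<close> times \<open>M_{-n}\<close> cancels this entry, with a
  factor \<open>\<tau>\<close> that does not depend on \<open>n\<close>.\<close>

definition \<tau> :: complex
  where "\<tau> = - 2 * \<psi> (sv_L 2) / \<psi> (sv_M 1)"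

fun D :: "sv_index \<Rightarrow> 'v \<Rightarrow> 'v" where
  "D (IL n) v = scale (1 / (of_int (n - 1) * \<psi> (sv_M 1))) (A (IM (1 - n)) v)"
| "D (IM n) v = scale (1 / (of_int n * \<psi> (sv_M 1)))
     (A (IL (1 - n)) v + scale \<tau> (A (IM (- n)) v))"
| "D (IY n) v = scale (1 / (of_int (2 * n) * \<psi> (sv_M 1))) (A (IY (- n)) v)"

lemma D_add: "D i (u + v) = D i u + D i v"
  by (cases i) (simp_all add: A_add mod.scale_right_distrib add_ac)

lemma D_scale: "D i (scale c v) = scale c (D i v)"
  by (cases i) (simp_all add: A_scale mod.scale_right_distrib mult_ac)

lemma D_zero [simp]: "D i 0 = 0"
  by (cases i) simp_all

lemma D_filt: "filt d v \<Longrightarrow> filt (d - wt i) (D i v)"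
proof (cases i)
  case (IL n)
  assume "filt d v"
  from A_filt[OF this, of "IM (1 - n)"] IL show ?thesis
    by (auto intro!: filt.scale simp: algebra_simps)
next
  case (IM n)
  assume "filt d v"
  from A_filt[OF this, of "IL (1 - n)"] A_filt[OF this, of "IM (- n)"] IM show ?thesis
    by (auto intro!: filt.scale filt.add)
next
  case (IY n)
  assume "filt d v"
  from A_filt[OF this, of "IY (- n)"] IY show ?thesis
    by (auto intro!: filt.scale)
qed

lemma sv_plus_gens: "sv_L 2 \<in> sv_plus" "sv_M 1 \<in> sv_plus" "sv_Y 1 \<in> sv_plus"
  using basis_vec_plus[of "IL 2"] basis_vec_plus[of "IM 1"] basis_vec_plus[of "IY 1"]
  by (simp_all add: sv_L_def sv_M_def sv_Y_def)

lemma \<psi>_zero: "\<psi> 0 = 0"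
  using \<psi>_scale[OF sv_plus_gens(1), of 0] by simp

lemma \<psi>_Y1: "\<psi> (sv_Y 1) = 0"
  using character by (simp add: whittaker_character_def)

lemma \<kappa>_M: "\<kappa> (IM m) j = (if j = IL (1 - m) then - of_int m * \<psi> (sv_M 1) else 0)"
  using \<psi>_scale[OF sv_plus_gens(2), of "- of_int m"]
  by (cases j) (auto simp: \<psi>_zero)

lemma \<kappa>_Y: "\<kappa> (IY m) j = (if j = IY (- m) then - of_int (2 * m) * \<psi> (sv_M 1) else 0)"
proof (cases j)
  case (IL n)
  have "\<psi> (- sv_scale c (sv_Y 1)) = 0" for c
    using \<psi>_scale[OF sv_plus_gens(3), of "- c"] by (simp add: \<psi>_Y1)
  moreover have "n + m = 1" if "1 - n = m" using that by simp
  ultimately show ?thesis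
    using IL by (auto simp: \<psi>_zero)
next
  case (IM n)
  then show ?thesis by (simp add: \<psi>_zero)
next
  case (IY n)
  have "sv_scale (of_int (- m - m)) (sv_M 1) = sv_scale (- of_int (2 * m)) (sv_M 1)"
    by simp
  then show ?thesis
    using IY \<psi>_scale[OF sv_plus_gens(2), of "- of_int (2 * m)"] by auto
qed

lemma \<kappa>_L: "\<kappa> (IL m) j = (if j = IM (1 - m) then of_int (1 - m) * \<psi> (sv_M 1)
    else if j = IL (2 - m) then of_int (2 * (1 - m)) * \<psi> (sv_L 2) else 0)"
proof (cases j)
  case (IL n)
  have coeff: "2 - m - m = 2 * (1 - m)" by simp
  have "sv_basis_bracket (IL m) (IL (2 - m)) = sv_scale (of_int (2 * (1 - m))) (sv_L 2)"
    unfolding sv_basis_bracket.simps coeff by simp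
  then have "\<psi> (sv_basis_bracket (IL m) (IL (2 - m))) = of_int (2 * (1 - m)) * \<psi> (sv_L 2)"
    by (simp only: \<psi>_scale sv_plus_gens)
  moreover have "1 - m + (1 - n) = 0 \<longleftrightarrow> n = 2 - m"
    by auto
  ultimately show ?thesis
    using IL by (simp del: sv_basis_bracket.simps)
next
  case (IM n)
  have "1 - m + - n = 0 \<longleftrightarrow> n = 1 - m"
    by auto
  with IM \<psi>_scale[OF sv_plus_gens(2), of "of_int (1 - m)"] show ?thesis
    by simp
next
  case (IY n)
  have "m + n = 1" if "1 - m + - n = 0"
    using that by simp
  with IY \<psi>_scale[OF sv_plus_gens(3)] \<psi>_Y1 show ?thesis
    by auto
qed

text \<open>The errors \<open>R l\<close> of the leading-order relations for \<open>A l\<close> combine linearly to the error for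
  \<open>D i\<close>; what remains to check is that the same combination of the constants \<open>\<kappa> l j\<close> is the
  Kronecker delta.\<close>

lemma D_X_commute:
  assumes v: "filt d v" and i: "1 \<le> wt i"
  shows "filt (d + wt j - wt i - 1) (D i (X j v) - X j (D i v) - (if i = j then v else 0))"
proof -
  let ?p = "\<psi> (sv_M 1)"
  let ?\<delta> = "if i = j then 1 else 0 :: complex"
  define R where "R l = A l (X j v) - X j (A l v) - scale (\<kappa> l j) v" for l
  have R: "filt (d + wt j - wt i - 1) (R l)" if "wt l = - wt i" for l
    using A_X_commute_leading[OF v, of l j] that by (simp add: R_def algebra_simps)
  have delta: "(if i = j then v else 0) = scale ?\<delta> v"
    by simp
  show ?thesis
  proof (cases i)
    case (IL n)
    let ?c = "1 / (of_int (n - 1) * ?p)"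
    have "of_int (n - 1) \<noteq> (0 :: complex)"
      using i IL by (simp only: of_int_eq_0_iff) simp
    then have c: "?\<delta> = ?c * \<kappa> (IM (1 - n)) j"
      using \<psi>_M1 unfolding \<kappa>_M IL by auto
    have "D i (X j v) - X j (D i v) - (if i = j then v else 0) = scale ?c (R (IM (1 - n)))"
      unfolding delta c unfolding R_def IL D.simps act_scale_right
      by (simp only: mod.scale_right_diff_distrib mod.scale_scale)
    then show ?thesis
      using R[of "IM (1 - n)"] IL by (simp add: filt.scale)
  next
    case (IM n)
    let ?c = "1 / (of_int n * ?p)"
    have "of_int n \<noteq> (0 :: complex)"
      using i IM by (simp only: of_int_eq_0_iff) simp
    then have c: "?\<delta> = ?c * \<kappa> (IL (1 - n)) j + ?c * \<tau> * \<kappa> (IM (- n)) j"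
      using \<psi>_M1 unfolding \<kappa>_M \<kappa>_L IM by (auto simp: \<tau>_def field_simps)
    have "D i (X j v) - X j (D i v) - (if i = j then v else 0)
        = scale ?c (R (IL (1 - n))) + scale (?c * \<tau>) (R (IM (- n)))"
      unfolding delta c unfolding R_def IM D.simps act_scale_right act_add_right
        mod.scale_right_diff_distrib mod.scale_right_distrib mod.scale_left_distrib mod.scale_scale
      by (simp only: algebra_simps)
    then show ?thesis
      using R[of "IL (1 - n)"] R[of "IM (- n)"] IM by (simp only: filt.scale filt.add wt.simps)
  next
    case (IY n)
    let ?c = "1 / (of_int (2 * n) * ?p)"
    have "of_int (2 * n) \<noteq> (0 :: complex)"
      using i IY by (simp only: of_int_eq_0_iff) simp
    then have c: "?\<delta> = ?c * \<kappa> (IY (- n)) j"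
      using \<psi>_M1 unfolding \<kappa>_Y IY by auto
    have "D i (X j v) - X j (D i v) - (if i = j then v else 0) = scale ?c (R (IY (- n)))"
      unfolding delta c unfolding R_def IY D.simps act_scale_right
      by (simp only: mod.scale_right_diff_distrib mod.scale_scale)
    then show ?thesis
      using R[of "IY (- n)"] IY by (simp add: filt.scale)
  qed
qed

text \<open>The Euler operator is an infinite sum that is finite on every vector, since \<open>D i\<close> kills
  \<open>filt d\<close> for \<open>wt i > d\<close>. The bound \<open>N\<close> truncates it to a linear operator that is correct on
  \<open>filt N\<close>.\<close>

definition euler :: "int \<Rightarrow> 'v \<Rightarrow> 'v"
  where "euler N v = (\<Sum>i | 1 \<le> wt i \<and> wt i \<le> N. scale (of_int (wt i)) (X i (D i v)))"

lemma euler_add: "euler N (u + v) = euler N u + euler N v"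
  by (simp add: euler_def D_add act_add_right mod.scale_right_distrib sum.distrib)

lemma euler_scale: "euler N (scale c v) = scale c (euler N v)"
  by (simp add: euler_def D_scale act_scale_right mod.scale_sum_right mult_ac)

lemma euler_zero [simp]: "euler N 0 = 0"
  by (simp add: euler_def)

text \<open>By the Leibniz rule, the commutator of the Euler operator with \<open>X j\<close> is the sum of the
  \<open>wt i \<cdot> X i \<circ> [D i, X j]\<close>, which is \<open>wt j \<cdot> X j\<close> to leading order, and of the
  \<open>wt i \<cdot> [X i, X j] \<circ> D i\<close>, which are of lower order because creating operators commute to leading
  order.\<close>

lemma euler_X_commute:
  assumes v: "filt d v" and j: "1 \<le> wt j" "wt j \<le> N"
  shows "filt (d + wt j - 1) (euler N (X j v) - X j (euler N v) - scale (of_int (wt j)) (X j v))"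
proof -
  let ?S = "{i. 1 \<le> wt i \<and> wt i \<le> N}"
  let ?R = "\<lambda>i. D i (X j v) - X j (D i v) - (if i = j then v else 0)"
  let ?C = "\<lambda>i. X i (X j (D i v)) - X j (X i (D i v))"
  have delta: "(\<Sum>i\<in>?S. scale (of_int (wt i)) (X i (if i = j then v else 0)))
      = scale (of_int (wt j)) (X j v)"
  proof -
    have "(\<Sum>i\<in>?S. scale (of_int (wt i)) (X i (if i = j then v else 0)))
      = (\<Sum>i\<in>?S. if i = j then scale (of_int (wt j)) (X j v) else 0)"
      by (intro sum.cong) auto
    with j show ?thesis
      by (simp add: finite_wt_bounded)
  qed
  have "euler N (X j v) - X j (euler N v) - scale (of_int (wt j)) (X j v)
    = (\<Sum>i\<in>?S. scale (of_int (wt i)) (X i (D i (X j v)))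
        - scale (of_int (wt i)) (X j (X i (D i v)))
        - scale (of_int (wt i)) (X i (if i = j then v else 0)))"
    unfolding sum_subtractf delta
    by (simp add: euler_def act_sum_right act_scale_right)
  also have "\<dots> = (\<Sum>i\<in>?S. scale (of_int (wt i)) (X i (?R i) + ?C i))"
    by (intro sum.cong refl)
       (simp only: act_diff_right mod.scale_right_diff_distrib mod.scale_right_distrib,
        simp add: algebra_simps)
  also have "filt (d + wt j - 1) \<dots>"
  proof (intro filt_sum filt.scale filt.add)
    fix i assume "i \<in> ?S"
    then have i: "1 \<le> wt i" by simp
    show "filt (d + wt j - 1) (X i (?R i))"
      by (rule filt.step[OF D_X_commute[OF v i] i]) simp
    have "filt (d + wt j - 1) (A i (X j (D i v)) - X j (A i (D i v)))"
      using A_X_commute_leading[OF D_filt[OF v, of i], of i j] i j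
      by (simp add: algebra_simps)
    then show "filt (d + wt j - 1) (?C i)"
      by (simp add: A_eq_X i)
  qed
  finally show ?thesis .
qed

lemma euler_leading: "filt d v \<Longrightarrow> d \<le> N \<Longrightarrow> filt (d - 1) (euler N v - scale (of_int d) v)"
proof (induction rule: filt.induct)
  case (zero d)
  then show ?case by (simp add: filt.zero)
next
  case (add d u v)
  from filt.add[OF add.IH(1)[OF add.prems] add.IH(2)[OF add.prems]] show ?case
    by (simp add: euler_add mod.scale_right_distrib algebra_simps)
next
  case (scale d v c)
  from filt.scale[OF scale.IH[OF scale.prems], of c] show ?case
    by (simp add: euler_scale mod.scale_right_diff_distrib mult.commute)
next
  case (gen d)
  have "D i w = 0" if "1 \<le> wt i" for i
  proof -
    have "filt (- wt i) (D i w)"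
      using D_filt[OF filt.gen[of 0], of i] by simp
    then show ?thesis
      using that by (intro filt_negative) auto
  qed
  then have "euler N w = 0"
    by (simp add: euler_def)
  moreover have "filt (d - 1) (scale (of_int d) w)"
    using gen by (cases "d = 0") (auto intro!: filt.intros(1) filt.scale filt.gen)
  ultimately show ?case
    by (simp add: filt_minus)
next
  case (step d v j e)
  show ?case
  proof (cases "d < 0")
    case True
    then have "v = 0"
      using step.hyps(1) filt_negative by blast
    then show ?thesis
      by (simp add: filt.zero)
  next
    case False
    have 1: "filt (e - 1) (euler N (X j v) - X j (euler N v) - scale (of_int (wt j)) (X j v))"
      using step False by (intro filt_mono[OF euler_X_commute[OF step.hyps(1)]]) auto
    have 2: "filt (e - 1) (X j (euler N v - scale (of_int d) v))"
      using step False by (intro filt.step[OF step.IH]) auto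
    \<comment> \<open>A word that does not reach the top degree is itself of lower order.\<close>
    have 3: "filt (e - 1) (scale (of_int (e - d - wt j)) (X j v))"
    proof (cases "e = d + wt j")
      case True
      then show ?thesis by (simp add: filt.zero)
    next
      case False
      with step show ?thesis
        by (intro filt.scale filt.step[OF step.hyps(1)]) auto
    qed
    have "euler N (X j v) - scale (of_int e) (X j v) =
      (euler N (X j v) - X j (euler N v) - scale (of_int (wt j)) (X j v))
      + X j (euler N v - scale (of_int d) v) - scale (of_int (e - d - wt j)) (X j v)"
      by (simp add: act_diff_right act_scale_right mod.scale_left_diff_distrib)
    then show ?thesis
      using filt_diff[OF filt.add[OF 1 2] 3] by (simp only:)
  qed
qed

text \<open>This replaces linear independence of the monomials: the common kernel of the derivatives lies in
  every step of the filtration from \<open>filt 0\<close> on, as it is killed by the Euler operator and \<open>d\<close> is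
  invertible.\<close>

lemma filt_descend:
  assumes "filt d v" "0 < d" "\<And>i. 1 \<le> wt i \<Longrightarrow> D i v = 0"
  shows "filt (d - 1) v"
proof -
  have "euler d v = 0"
    using assms(3) by (simp add: euler_def)
  then have "filt (d - 1) (scale (- 1 / of_int d) (- scale (of_int d) v))"
    using euler_leading[OF assms(1), of d] by (intro filt.scale) simp
  then show ?thesis
    using assms(2) by simp
qed

section \<open>Submodules\<close>

context
  fixes U :: "'v set"
  assumes U: "lie_submodule scale act U"
begin

lemma subspace_U: "mod.subspace U" and act_U: "u \<in> U \<Longrightarrow> act x u \<in> U"
  using U by (auto simp: lie_submodule_def)

lemma D_U: "u \<in> U \<Longrightarrow> D i u \<in> U"
  using subspace_U
  by (cases i) (simp_all add: A_def act_U mod.subspace_add mod.subspace_diff mod.subspace_scale mod.subspace_neg)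

lemma whittaker_vector_in_submodule:
  assumes "filt d v" "v \<in> U" "v \<noteq> 0"
  shows "w \<in> U"
  using assms
proof (induction "nat d" arbitrary: d v rule: less_induct)
  case less
  have "0 \<le> d"
    using filt_negative less.prems by force
  show ?case
  proof (cases "d = 0")
    case True
    then obtain c where c: "v = scale c w"
      using filt_0 less.prems by blast
    then have "scale (inverse c) v = w"
      using less.prems by auto
    then show ?thesis
      using less.prems subspace_U mod.subspace_scale by metis
  next
    case False
    then have d: "0 < d" using \<open>0 \<le> d\<close> by simp
    show ?thesis
    proof (cases "\<exists>i. 1 \<le> wt i \<and> D i v \<noteq> 0")
      case True
      then obtain i where "1 \<le> wt i" "D i v \<noteq> 0" by blast
      then show ?thesis
        using less.hyps[of "d - wt i" "D i v"] D_filt[OF less.prems(1)] D_U less.prems d by auto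
    next
      case False
      then have "filt (d - 1) v"
        using filt_descend less.prems d by blast
      then show ?thesis
        using less.hyps[of "d - 1"] less.prems d by auto
    qed
  qed
qed

end

text \<open>Hence a module generated by \<open>w\<close> is exhausted by the filtration.\<close>

lemma submodule_filt: "lie_submodule scale act {v. \<exists>d. filt d v}"
proof -
  let ?F = "{v. \<exists>d. filt d v}"
  have sub: "mod.subspace ?F"
  proof (rule mod.subspaceI)
    show "u + v \<in> ?F" if uv: "u \<in> ?F" "v \<in> ?F" for u v
    proof -
      from uv obtain d e where de: "filt d u" "filt e v" by blast
      then have "filt (max d e) u" "filt (max d e) v"
        using filt_mono by (meson max.cobounded1 max.cobounded2)+
      then show ?thesis
        using filt.add by blast
    qed
  qed (auto intro: filt.intros)
  have "act x v \<in> ?F" if v: "v \<in> ?F" for x v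
  proof (induction x rule: sv_induct)
    case zero
    show ?case
      using act_scale_left[of 0 0 v] mod.subspace_0[OF sub] by simp
  next
    case (add x y)
    then show ?case
      by (simp only: act_add_left mod.subspace_add[OF sub])
  next
    case (scale c x)
    then show ?case
      by (simp only: act_scale_left mod.subspace_scale[OF sub])
  next
    case (basis i)
    have "X i v = A i v + scale (\<chi> i) v"
      by (simp add: A_def)
    moreover have "A i v \<in> ?F"
      using v A_filt by blast
    ultimately show ?case
      using v by (simp only: mod.subspace_add[OF sub] mod.subspace_scale[OF sub])
  qed
  with sub show ?thesis
    by (simp add: lie_submodule_def)
qed

end

theorem theorem4p8:
  fixes \<psi> :: "sv \<Rightarrow> complex"
    and scale :: "complex \<Rightarrow> 'v::ab_group_add \<Rightarrow> 'v"
    and act :: "sv \<Rightarrow> 'v \<Rightarrow> 'v"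
    and \<xi> :: complex
  assumes "whittaker_character \<psi>"
    and "\<psi> (sv_M 1) \<noteq> 0"
    and "whittaker_module scale act \<psi>"
    and "(UNIV :: 'v set) \<noteq> {0}"
    and "\<And>v. act (sv_M 0) v = scale \<xi> v"
  shows "irreducible_lie_module scale act"
proof -
  obtain w where lm: "lie_module sv_scale sv_bracket scale act"
      and w: "whittaker_vector scale act \<psi> w"
      and hull: "lie_submodule scale act hull {w} = UNIV"
    using assms(3) by (auto simp: whittaker_module_def)
  interpret scalar_whittaker scale act \<psi> \<xi> w
    using lm w assms by (simp add: scalar_whittaker_def scalar_whittaker_axioms_def)
  have generates: "U = UNIV" if "lie_submodule scale act U" "w \<in> U" for U
    using hull_minimal[of "{w}" U "lie_submodule scale act"] that hull by auto
  have exhaust: "\<exists>d. filt d v" for v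
    using generates[OF submodule_filt] filt.gen[of 0] by auto
  have "U = {0} \<or> U = UNIV" if U: "lie_submodule scale act U" for U
  proof (cases "\<exists>v\<in>U. v \<noteq> 0")
    case True
    then show ?thesis
      using whittaker_vector_in_submodule[OF U] exhaust generates[OF U] by blast
  next
    case False
    then show ?thesis
      using mod.subspace_0[OF subspace_U[OF U]] by auto
  qed
  with assms(4) show ?thesis
    by (simp add: irreducible_lie_module_def)
qed

end
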